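(* Let $\Gamma$ be a smooth closed convex plane bicycle curve of perimeter length $2\pi$ with rotation number $\rho$. Then every arc of $\Gamma$ of length $2\pi\rho$ contains a vertex of $\Gamma$.
   Context: A closed smooth convex plane curve $\Gamma$ of perimeter length $2\pi$, parameterized by arc length as $\Gamma:\mathbf{R}/2\pi\mathbf{Z}\to\mathbf{R}^2$, is a bicycle curve with rotation number $\rho\in(0,1)$ if the distance $|\Gamma(x+2\pi\rho)-\Gamma(x)|$ does not depend on $x$. A vertex of a smooth plane curve is a local maximum or local minimum (not necessarily strict) of its curvature. *)

theory Defs
  imports "HOL-Analysis.Analysis"
begin

definition iterated_vector_derivative ::
  "nat \<Rightarrow> (real \<Rightarrow> 'a::real_normed_vector) \<Rightarrow> real \<Rightarrow> 'a" where
  "iterated_vector_derivative n f = ((\<lambda>g x. vector_derivative g (at x)) ^^ n) f"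

definition smooth_curve :: "(real \<Rightarrow> 'a::real_normed_vector) \<Rightarrow> bool" where
  "smooth_curve f \<longleftrightarrow> (\<forall>n x. iterated_vector_derivative n f differentiable (at x))"

text \<open>Signed curvature of a regular parametrized plane curve; for unit speed the
  denominator is 1. Reversing the orientation negates it, which exchanges local maxima
  and local minima.\<close>

definition curvature :: "(real \<Rightarrow> real^2) \<Rightarrow> real \<Rightarrow> real" where
  "curvature \<Gamma> x =
     (let v = iterated_vector_derivative 1 \<Gamma> x; w = iterated_vector_derivative 2 \<Gamma> x
      in (v $ 1 * w $ 2 - v $ 2 * w $ 1) / norm v ^ 3)"

text \<open>A closed curve of length \<open>2 * pi\<close> on the circle \<open>\<real> / 2\<pi>\<int>\<close> is represented by a
  \<open>2 * pi\<close>-periodic unit-speed function on the reals. Convexity: the curve is simple and its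
  trace is the whole boundary of a planar convex body. Straight pieces (zero curvature)
  are allowed.\<close>

definition closed_convex_curve :: "(real \<Rightarrow> real^2) \<Rightarrow> bool" where
  "closed_convex_curve \<Gamma> \<longleftrightarrow>
     smooth_curve \<Gamma> \<and>
     (\<forall>x. \<Gamma> (x + 2 * pi) = \<Gamma> x) \<and>
     (\<forall>x. norm (vector_derivative \<Gamma> (at x)) = 1) \<and>
     inj_on \<Gamma> {0..<2 * pi} \<and>
     (\<exists>K. convex K \<and> compact K \<and> interior K \<noteq> {} \<and> frontier K = range \<Gamma>)"

definition bicycle_curve :: "(real \<Rightarrow> real^2) \<Rightarrow> real \<Rightarrow> bool" where
  "bicycle_curve \<Gamma> \<rho> \<longleftrightarrow>
     closed_convex_curve \<Gamma> \<and> 0 < \<rho> \<and> \<rho> < 1 \<and>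
     (\<exists>l. \<forall>x. dist (\<Gamma> (x + 2 * pi * \<rho>)) (\<Gamma> x) = l)"

text \<open>The neighbourhoods are those of the parameter on the whole curve, also when \<open>x\<close> is an
  endpoint of an arc under consideration.\<close>

definition vertex_at :: "(real \<Rightarrow> real^2) \<Rightarrow> real \<Rightarrow> bool" where
  "vertex_at \<Gamma> x \<longleftrightarrow>
     (\<forall>\<^sub>F y in nhds x. curvature \<Gamma> y \<le> curvature \<Gamma> x) \<or>
     (\<forall>\<^sub>F y in nhds x. curvature \<Gamma> x \<le> curvature \<Gamma> y)"

end

(* Let D be the chord of an arc of length 2 pi rho, y the height of the curve over the chord and
   c = D . T. Differentiating the constant squared chord length gives c(a) = c(b): tangents make
   equal angles with the chord. If the arc has no vertex inside, its curvature k is strictly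
   monotone, and by Vogt's theorem these angles would then differ. For a proof: by convexity y has a
   single turning point m on [a, b], so (k - k(m)) y' has constant sign; but it is the derivative
   of - c - k(m) y, which takes the same value at a and b. Hence y' vanishes, the arc is straight
   and k = 0, a contradiction. *)

theory Submission
  imports Defs
begin

section \<open>Lines and the frontier of a planar convex set\<close>

text \<open>Differences of points of \<open>S\<close> are orthogonal to \<open>w\<close>, and in the
  plane the orthogonal complement of \<open>w\<close> is spanned by its quarter turn
  \<open>n\<close>.\<close>

lemma collinear_orthogonal_complement:
  fixes w :: "real^2"
  assumes "w \<noteq> 0" "\<And>x y. x \<in> S \<Longrightarrow> y \<in> S \<Longrightarrow> w \<bullet> x = w \<bullet> y"
  shows "collinear S"
proof -
  define n :: "real^2" where "n = vector [- w $ 2, w $ 1]"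
  have pos: "w $ 1 * w $ 1 + w $ 2 * w $ 2 \<noteq> 0"
    using assms(1) by (auto simp: vec_eq_iff forall_2 sum_squares_eq_zero_iff)
  have "\<exists>c. x - y = c *\<^sub>R n" if "x \<in> S" "y \<in> S" for x y
  proof -
    have "w $ 1 * (x - y) $ 1 + w $ 2 * (x - y) $ 2 = 0"
      using assms(2)[OF that] by (simp add: inner_vec_def sum_2 algebra_simps)
    then have e: "w $ 1 * x $ 1 = w $ 1 * y $ 1 - w $ 2 * (x - y) $ 2"
      "w $ 2 * x $ 2 = w $ 2 * y $ 2 - w $ 1 * (x - y) $ 1"
      by (simp_all add: algebra_simps)
    \<comment> \<open>The coefficient of the projection of \<open>x - y\<close> onto
      \<open>n\<close>; the denominator is \<open>n \<bullet> n\<close>.\<close>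
    define c where "c = (n \<bullet> (x - y)) / (w $ 1 * w $ 1 + w $ 2 * w $ 2)"
    have c: "c * (w $ 1 * w $ 1 + w $ 2 * w $ 2) = w $ 1 * (x - y) $ 2 - w $ 2 * (x - y) $ 1"
      using pos by (simp add: c_def n_def inner_vec_def sum_2)
    have "(x - y) $ 1 = c * - w $ 2"
      "(x - y) $ 2 = c * w $ 1"
      using c e pos by (simp_all, algebra+)
    then show ?thesis by (intro exI[of _ c]) (simp add: vec_eq_iff forall_2 n_def)
  qed
  then show ?thesis unfolding collinear_def by blast
qed

lemma parallel_if_orthogonal_common:
  fixes u w n :: "real^2"
  assumes "w \<noteq> 0" "n \<noteq> 0" "w \<bullet> n = 0" "u \<bullet> n = 0"
  obtains r where "u = r *\<^sub>R w"
proof -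
  have "collinear {0, w, u}"
    using assms by (intro collinear_orthogonal_complement[of n]) (auto simp: inner_commute)
  then show ?thesis
    using assms(1) that by (auto simp: collinear_lemma)
qed

text \<open>A supporting line at the middle point also contains the two outer ones, so it is the given
  line; but that one separates \<open>X\<close> from \<open>Y\<close>.\<close>

lemma supporting_line_at_middle_point:
  fixes K :: "(real^2) set"
  assumes K: "convex K" "interior K \<noteq> {}"
    and PQR: "P \<in> frontier K" "Q \<in> frontier K" "R \<in> frontier K" "Q \<in> open_segment P R"
    and w: "w \<noteq> 0" "w \<bullet> P = w \<bullet> R"
    and XY: "X \<in> frontier K" "Y \<in> frontier K" "w \<bullet> X < w \<bullet> Q" "w \<bullet> Q < w \<bullet> Y"
  shows False
proof -
  have cl: "z \<in> closure K" if "z \<in> frontier K" for z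
    using that by (simp add: frontier_def)
  have "Q \<notin> rel_interior K"
    using PQR(2) K by (simp add: frontier_def rel_interior_nonempty_interior)
  then obtain u where u: "u \<noteq> 0" "\<And>y. y \<in> closure K \<Longrightarrow> u \<bullet> Q \<le> u \<bullet> y"
    using supporting_hyperplane_relative_frontier[OF K(1) cl[OF PQR(2)]] by metis
  obtain s where s: "P \<noteq> R" "0 < s" "s < 1" "Q = (1 - s) *\<^sub>R P + s *\<^sub>R R"
    using PQR(4) by (auto simp: in_segment)
  have "u \<bullet> Q = (1 - s) * (u \<bullet> P) + s * (u \<bullet> R)"
    using s by (simp add: inner_add_right)
  moreover have "u \<bullet> Q \<le> u \<bullet> P" "u \<bullet> Q \<le> u \<bullet> R"
    using u(2) cl PQR by auto
  ultimately have "(1 - s) * (u \<bullet> P - u \<bullet> Q) + s * (u \<bullet> R - u \<bullet> Q) = 0"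
    and "0 \<le> u \<bullet> P - u \<bullet> Q" "0 \<le> u \<bullet> R - u \<bullet> Q"
    by (simp_all add: algebra_simps)
  \<comment> \<open>Two nonnegative numbers with positive weights sum to zero, so both outer points
    lie on the supporting line.\<close>
  then have "u \<bullet> P - u \<bullet> Q = 0" "u \<bullet> R - u \<bullet> Q = 0"
    using s by (smt (verit) mult_pos_pos mult_nonneg_nonneg)+
  then have "u \<bullet> (P - R) = 0" by (simp add: inner_diff_right)
  moreover have "w \<bullet> (P - R) = 0" using w by (simp add: inner_diff_right)
  ultimately obtain r where r: "u = r *\<^sub>R w"
    using parallel_if_orthogonal_common[of w "P - R" u] w s by auto
  \<comment> \<open>The sign of \<open>r\<close> is unknown, so support is tested on both sides of
    the line; together \<open>X\<close> and \<open>Y\<close> force \<open>r = 0\<close>.\<close>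
  have "r * (w \<bullet> Q) \<le> r * (w \<bullet> X)" "r * (w \<bullet> Q) \<le> r * (w \<bullet> Y)"
    using u(2) cl XY r by force+
  then show False using XY r u(1)
    by (smt (verit) mult_less_cancel_left scaleR_eq_0_iff)
qed

text \<open>One of three distinct collinear points lies strictly between the others.
  \<open>X\<close> and \<open>Y\<close> rule out a supporting line, which may meet the frontier in a
  whole segment.\<close>

lemma line_meets_convex_frontier_twice:
  fixes K :: "(real^2) set"
  assumes K: "convex K" "interior K \<noteq> {}"
    and PQR: "P \<in> frontier K" "Q \<in> frontier K" "R \<in> frontier K"
    and distinct: "P \<noteq> Q" "Q \<noteq> R" "P \<noteq> R"
    and w: "w \<noteq> 0" "w \<bullet> P = d" "w \<bullet> Q = d" "w \<bullet> R = d"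
    and XY: "X \<in> frontier K" "Y \<in> frontier K" "w \<bullet> X < d" "d < w \<bullet> Y"
  shows False
proof -
  have "collinear {P, Q, R}"
    using w by (intro collinear_orthogonal_complement[of w]) auto
  then have "P \<in> open_segment Q R \<or> Q \<in> open_segment R P \<or> R \<in> open_segment P Q"
    using distinct by (auto simp: collinear_between_cases between_mem_segment open_segment_def)
  then show False
    using supporting_line_at_middle_point[OF K _ _ _ _ w(1) _ XY(1,2)] PQR w XY by metis
qed

section \<open>Unimodality of the height function\<close>

text \<open>A convex curve with straight pieces can attain an extreme height on a whole interval, so
  only levels with values strictly below and strictly above them are restricted.\<close>

definition levels_at_most_twice :: "(real \<Rightarrow> real) \<Rightarrow> real set \<Rightarrow> bool" where
  "levels_at_most_twice g S \<longleftrightarrow> (\<forall>p\<in>S. \<forall>q\<in>S. \<forall>r\<in>S. \<forall>u\<in>S. \<forall>v\<in>S.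
     p < q \<and> q < r \<and> g p = g q \<and> g q = g r \<longrightarrow> \<not> (g u < g q \<and> g q < g v))"

lemma levels_at_most_twiceD:
  assumes "levels_at_most_twice g S" "p \<in> S" "q \<in> S" "r \<in> S" "u \<in> S" "v \<in> S"
    "p < q" "q < r" "g p = g q" "g q = g r" "g u < g q" "g q < g v"
  shows False
  using assms unfolding levels_at_most_twice_def by blast

lemma levels_at_most_twice_uminus:
  "levels_at_most_twice g S \<Longrightarrow> levels_at_most_twice (\<lambda>t. - g t) S"
  by (auto simp: levels_at_most_twice_def)

text \<open>If \<open>g v\<close> exceeded both \<open>g u\<close> and \<open>g w\<close>, a level
  in between would be met three times: on the way from \<open>g a\<close> down to
  \<open>g u\<close>, up to \<open>g v\<close> and down to \<open>g w\<close>. So \<open>g\<close>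
  is quasiconvex, hence falls up to a minimum point and rises after it.\<close>

lemma unimodal_if_levels_twice_below:
  fixes g :: "real \<Rightarrow> real"
  assumes "a < b" and cont: "continuous_on {a..b} g" and "g a = g b"
    and top: "\<And>t. t \<in> {a..b} \<Longrightarrow> g t \<le> g a"
    and twice: "levels_at_most_twice g {a..b}"
  obtains m where "m \<in> {a..b}" "antimono_on {a..m} g" "mono_on {m..b} g"
proof -
  have quasiconvex: "g v \<le> max (g u) (g w)" if ord: "a \<le> u" "u \<le> v" "v \<le> w" "w \<le> b" for u v w
  proof (rule ccontr)
    assume "\<not> g v \<le> max (g u) (g w)"
    then obtain d where d: "g u < d" "g w < d" "d < g v"
      using dense[of "max (g u) (g w)" "g v"] by force
    have "d < g a" using d top[of v] ord by auto
    have sub: "continuous_on {x..y} g" if "a \<le> x" "y \<le> b" for x y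
      using cont by (rule continuous_on_subset) (use that in auto)
    obtain p where p: "a \<le> p" "p \<le> u" "g p = d"
      using IVT2'[of g u d a] sub[of a u] \<open>d < g a\<close> d ord by force
    obtain q where q: "u \<le> q" "q \<le> v" "g q = d"
      using IVT'[of g u d v] sub[of u v] d ord by force
    obtain r where r: "v \<le> r" "r \<le> w" "g r = d"
      using IVT2'[of g w d v] sub[of v w] d ord by force
    have "p \<noteq> u" "q \<noteq> v" using p q d by auto
    then show False
      using levels_at_most_twiceD[OF twice, of p q r u v] p q r d ord by force
  qed
  obtain m where m: "m \<in> {a..b}" "\<And>t. t \<in> {a..b} \<Longrightarrow> g m \<le> g t"
    using continuous_attains_inf[OF compact_Icc _ cont] \<open>a < b\<close> by auto
  show ?thesis
  proof
    show "antimono_on {a..m} g"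
    proof (rule monotone_onI)
      fix x y assume "x \<in> {a..m}" "y \<in> {a..m}" "x \<le> y"
      then show "g y \<le> g x" using quasiconvex[of x y m] m(1) m(2)[of x] by auto
    qed
    show "mono_on {m..b} g"
    proof (rule monotone_onI)
      fix x y assume "x \<in> {m..b}" "y \<in> {m..b}" "x \<le> y"
      then show "g x \<le> g y" using quasiconvex[of m x y] m(1) m(2)[of y] by auto
    qed
  qed (use m in auto)
qed

text \<open>Puts both branches into one sign condition, which can later be multiplied with the one
  for the curvature.\<close>

lemma unimodal_derivative_if_levels_twice_below:
  fixes g :: "real \<Rightarrow> real"
  assumes "a < b" and deriv: "\<And>t. (g has_real_derivative g' t) (at t)" and "g a = g b"
    and top: "\<And>t. t \<in> {a..b} \<Longrightarrow> g t \<le> g a"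
    and twice: "levels_at_most_twice g {a..b}"
  obtains m where "m \<in> {a..b}" "\<And>t. t \<in> {a<..<b} \<Longrightarrow> 0 \<le> (t - m) * g' t"
proof -
  have "continuous_on {a..b} g"
    using deriv by (meson DERIV_continuous continuous_at_imp_continuous_on)
  then obtain m where m: "m \<in> {a..b}" "antimono_on {a..m} g" "mono_on {m..b} g"
    using unimodal_if_levels_twice_below[OF \<open>a < b\<close> _ \<open>g a = g b\<close> top twice] by blast
  have "0 \<le> (t - m) * g' t" if t: "t \<in> {a<..<b}" for t
  proof -
    consider "t < m" | "t = m" | "m < t" by linarith
    then show ?thesis
    proof cases
      case 1
      have "mono_on {a..m} (\<lambda>t. - g t)"
        using m(2) by (auto simp: monotone_on_def)
      then have "0 \<le> - g' t"
        using 1 t by (intro mono_on_imp_deriv_nonneg[OF _ DERIV_minus[OF deriv]]) auto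
      with 1 show ?thesis by (simp add: zero_le_mult_iff)
    next
      case 3
      have "0 \<le> g' t"
        using 3 t by (intro mono_on_imp_deriv_nonneg[OF m(3) deriv]) auto
      with 3 show ?thesis by simp
    qed simp
  qed
  with m(1) show ?thesis using that by blast
qed

text \<open>With values on both sides of \<open>g a\<close>, \<open>g\<close> would pass this level
  strictly inside, a third time besides \<open>a\<close> and \<open>b\<close>. So \<open>g\<close>
  or \<open>- g\<close> stays below its end values; \<open>\<sigma>\<close> records which.\<close>

lemma unimodal_derivative_if_levels_twice:
  fixes g :: "real \<Rightarrow> real"
  assumes "a < b" and deriv: "\<And>t. (g has_real_derivative g' t) (at t)" and "g a = g b"
    and twice: "levels_at_most_twice g {a..b}"
  obtains m \<sigma> where "m \<in> {a..b}" "\<sigma> \<noteq> 0" "\<And>t. t \<in> {a<..<b} \<Longrightarrow> 0 \<le> \<sigma> * ((t - m) * g' t)"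
proof -
  have cont: "continuous_on {x..y} g" for x y
    using deriv by (meson DERIV_continuous continuous_at_imp_continuous_on)
  have one_side: False if "t \<in> {a..b}" "u \<in> {a..b}" "g t < g a" "g a < g u" for t u
  proof -
    have ne: "t \<noteq> a" "t \<noteq> b" "u \<noteq> a" "u \<noteq> b" using that \<open>g a = g b\<close> by auto
    have "\<exists>q. min t u \<le> q \<and> q \<le> max t u \<and> g q = g a"
      using IVT'[of g t "g a" u] IVT2'[of g t "g a" u] cont that(3,4)
      by (cases "t \<le> u") (force simp: min_def max_def)+
    then obtain q where q: "min t u \<le> q" "q \<le> max t u" "g q = g a" by blast
    then show False using levels_at_most_twiceD[OF twice, of a q b t u] that q ne \<open>g a = g b\<close> by force
  qed
  show ?thesis
  proof (cases "\<forall>t\<in>{a..b}. g t \<le> g a")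
    case True
    then obtain m where "m \<in> {a..b}" "\<And>t. t \<in> {a<..<b} \<Longrightarrow> 0 \<le> (t - m) * g' t"
      using unimodal_derivative_if_levels_twice_below[OF \<open>a < b\<close> deriv \<open>g a = g b\<close> _ twice]
      by blast
    then show ?thesis using that[of m 1] by simp
  next
    case False
    then have "- g t \<le> - g a" if "t \<in> {a..b}" for t
      using one_side[OF that] by force
    then obtain m where "m \<in> {a..b}" "\<And>t. t \<in> {a<..<b} \<Longrightarrow> 0 \<le> (t - m) * - g' t"
      using unimodal_derivative_if_levels_twice_below[OF \<open>a < b\<close> DERIV_minus[OF deriv] _ _
          levels_at_most_twice_uminus[OF twice]] \<open>g a = g b\<close>
      by (metis (lifting))
    then show ?thesis using that[of m "-1"] by simp
  qed
qed

section \<open>Continuous functions without local extrema\<close>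

text \<open>Suppose \<open>f u = f v\<close>. An extremum over \<open>{u..v}\<close> at an inner
  point would be a local one. If both extrema are taken at the ends, \<open>f\<close> is constant
  there, and the midpoint is a local maximum.\<close>

lemma inj_on_if_no_local_extremum:
  fixes f :: "real \<Rightarrow> real"
  assumes cont: "continuous_on {a..b} f"
    and no_max: "\<And>x. x \<in> {a<..<b} \<Longrightarrow> \<not> (\<forall>\<^sub>F y in nhds x. f y \<le> f x)"
    and no_min: "\<And>x. x \<in> {a<..<b} \<Longrightarrow> \<not> (\<forall>\<^sub>F y in nhds x. f x \<le> f y)"
  shows "inj_on f {a..b}"
proof (rule linorder_inj_onI)
  fix u v assume uv: "u < v" "u \<in> {a..b}" "v \<in> {a..b}"
  show "f u \<noteq> f v"
  proof
    assume eq: "f u = f v"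
    have c: "continuous_on {u..v} f"
      using cont by (rule continuous_on_subset) (use uv in auto)
    obtain M where M: "M \<in> {u..v}" "\<And>t. t \<in> {u..v} \<Longrightarrow> f t \<le> f M"
      using continuous_attains_sup[OF compact_Icc _ c] uv by auto
    obtain m where m: "m \<in> {u..v}" "\<And>t. t \<in> {u..v} \<Longrightarrow> f m \<le> f t"
      using continuous_attains_inf[OF compact_Icc _ c] uv by auto
    have ev: "\<forall>\<^sub>F y in nhds x. y \<in> {u<..<v}" if "x \<in> {u<..<v}" for x
      using that by (intro eventually_nhds_in_open) auto
    have "M \<notin> {u<..<v}"
      using no_max[of M] eventually_mono[OF ev, of M "\<lambda>y. f y \<le> f M"] M uv by auto
    moreover have "m \<notin> {u<..<v}"
      using no_min[of m] eventually_mono[OF ev, of m "\<lambda>y. f m \<le> f y"] m uv by auto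
    ultimately have const: "f t = f u" if "t \<in> {u..v}" for t
      using M m eq that by (smt (verit) atLeastAtMost_iff greaterThanLessThan_iff)
    have mid: "(u + v) / 2 \<in> {u<..<v}" using uv by auto
    have "\<forall>\<^sub>F y in nhds ((u + v) / 2). f y \<le> f ((u + v) / 2)"
    proof (rule eventually_mono[OF ev[OF mid]])
      fix y assume "y \<in> {u<..<v}"
      then show "f y \<le> f ((u + v) / 2)"
        using const[of y] const[of "(u + v) / 2"] mid by auto
    qed
    then show False
      using no_max[of "(u + v) / 2"] mid uv by auto
  qed
qed auto

text \<open>One inequality covers increasing and decreasing \<open>f\<close>: \<open>\<tau>\<close>
  carries the direction and is taken to be \<open>f b - f a\<close>. Values at any three points are
  ordered monotonically, so every pair follows the direction of the end points.\<close>

lemma strictly_monotone_sign_if_inj_on: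
  fixes f :: "real \<Rightarrow> real"
  assumes "a < b" and cont: "continuous_on {a..b} f" and inj: "inj_on f {a..b}"
  obtains \<tau> where "\<tau> \<noteq> 0"
    "\<And>x y. x \<in> {a..b} \<Longrightarrow> y \<in> {a..b} \<Longrightarrow> x \<noteq> y \<Longrightarrow> 0 < \<tau> * ((x - y) * (f x - f y))"
proof -
  have mid: "(f x < f y \<and> f y < f z) \<or> (f z < f y \<and> f y < f x)"
    if "a \<le> x" "x < y" "y < z" "z \<le> b" for x y z
  proof (rule continuous_inj_imp_mono[OF that(2,3)])
    show "continuous_on {x..z} f" using cont by (rule continuous_on_subset) (use that in auto)
    show "inj_on f {x..z}" using inj by (rule inj_on_subset) (use that in auto)
  qed
  have ne: "f a \<noteq> f b" using inj \<open>a < b\<close> by (auto simp: inj_on_eq_iff)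
  have lt: "(f a < f b \<longrightarrow> f x < f y) \<and> (f b < f a \<longrightarrow> f y < f x)" if "a \<le> x" "x < y" "y \<le> b" for x y
    using mid[of a x y] mid[of a x b] mid[of a y b] mid[of x y b] that
    by (cases "a = x"; cases "y = b") auto
  have "0 < (f b - f a) * ((x - y) * (f x - f y))" if "x \<in> {a..b}" "y \<in> {a..b}" "x \<noteq> y" for x y
    using lt[of x y] lt[of y x] that ne
    by (cases "f a < f b"; cases "x < y") (auto simp: zero_less_mult_iff mult_less_0_iff)
  then show ?thesis using that[of "f b - f a"] ne by auto
qed

section \<open>Vogt's theorem for an arc and its chord\<close>

text \<open>Detached from the curve: \<open>y\<close> is the height over the chord, \<open>p\<close>
  and \<open>c\<close> are the tangent components across and along the chord, all scaled by the
  chord length, and \<open>k\<close> is the curvature. The equations for \<open>c\<close> and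
  \<open>p\<close> are those of Frenet; \<open>nz\<close> says that the tangent does not
  vanish.\<close>

lemma monotone_curvature_unequal_angles:
  fixes y p c k :: "real \<Rightarrow> real"
  assumes "a < b"
    and dy: "\<And>t. (y has_real_derivative p t) (at t)"
    and dc: "\<And>t. (c has_real_derivative - (k t * p t)) (at t)"
    and dp: "\<And>t. (p has_real_derivative k t * c t) (at t)"
    and nz: "\<And>t. p t \<noteq> 0 \<or> c t \<noteq> 0"
    and twice: "levels_at_most_twice y {a..b}"
    and cont: "continuous_on {a..b} k" and inj: "inj_on k {a..b}"
    and "y a = y b"
  shows "c a \<noteq> c b"
proof
  assume "c a = c b"
  obtain m \<sigma> where m: "m \<in> {a..b}" and \<sigma>: "\<sigma> \<noteq> 0"
    "\<And>t. t \<in> {a<..<b} \<Longrightarrow> 0 \<le> \<sigma> * ((t - m) * p t)"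
    using unimodal_derivative_if_levels_twice[OF \<open>a < b\<close> dy \<open>y a = y b\<close> twice] by blast
  obtain \<tau> where \<tau>: "\<tau> \<noteq> 0"
    "\<And>x y. x \<in> {a..b} \<Longrightarrow> y \<in> {a..b} \<Longrightarrow> x \<noteq> y \<Longrightarrow> 0 < \<tau> * ((x - y) * (k x - k y))"
    using strictly_monotone_sign_if_inj_on[OF \<open>a < b\<close> cont inj] by blast
  \<comment> \<open>The factor \<open>\<sigma> * \<tau>\<close> normalizes the two unknown
    directions so that \<open>F\<close> is nondecreasing.\<close>
  define F where "F t = \<sigma> * \<tau> * (- c t - k m * y t)" for t
  have dF: "(F has_real_derivative \<sigma> * \<tau> * ((k t - k m) * p t)) (at t)" for t
    unfolding F_def
    by (auto intro!: derivative_eq_intros dy dc simp: algebra_simps)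
  have nonneg: "0 \<le> \<sigma> * \<tau> * ((k t - k m) * p t)" if "t \<in> {a<..<b}" for t
  proof (cases "t = m")
    case False
    \<comment> \<open>Both sign conditions carry the factor \<open>t - m\<close>; in their product
      it becomes a square and cancels.\<close>
    have "0 \<le> (\<sigma> * ((t - m) * p t)) * (\<tau> * ((t - m) * (k t - k m)))"
      using \<sigma>(2)[OF that] \<tau>(2)[of t m] that m False
      by (intro mult_nonneg_nonneg[of "\<sigma> * _" "\<tau> * _"]) (auto intro: less_imp_le)
    also have "\<dots> = (t - m)\<^sup>2 * (\<sigma> * \<tau> * ((k t - k m) * p t))"
      by (simp add: power2_eq_square)
    finally show ?thesis
      using False by (simp add: zero_le_mult_iff)
  qed simp
  have F_mono: "F u \<le> F v" if "a \<le> u" "u \<le> v" "v \<le> b" for u v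
  proof (rule DERIV_nonneg_imp_increasing_open[OF that(2)])
    show "continuous_on {u..v} F"
      using dF by (meson DERIV_continuous continuous_at_imp_continuous_on)
    show "\<exists>y. (F has_real_derivative y) (at x) \<and> 0 \<le> y" if "u < x" "x < v" for x
      using dF[of x] nonneg[of x] that \<open>a \<le> u\<close> \<open>v \<le> b\<close> by auto
  qed
  have "F a = F b"
    using \<open>y a = y b\<close> \<open>c a = c b\<close> by (simp add: F_def)
  then have F_const: "F t = F a" if "t \<in> {a<..<b}" for t
    using F_mono[of a t] F_mono[of t b] that by auto
  \<comment> \<open>\<open>F\<close> is constant, so its derivative vanishes; away from
    \<open>m\<close> the factor \<open>k t - k m\<close> is nonzero, which leaves
    \<open>p t = 0\<close>.\<close>
  have p0: "p t = 0" if "t \<in> {a<..<b} - {m}" for t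
  proof -
    have "(F has_real_derivative 0) (at t)"
      by (rule has_field_derivative_transform_within_open[of "\<lambda>_. F a" _ _ "{a<..<b}"])
        (use that F_const in auto)
    then have "\<sigma> * \<tau> * ((k t - k m) * p t) = 0"
      using dF DERIV_unique by blast
    then show ?thesis
      using \<sigma>(1) \<tau>(1) \<tau>(2)[of t m] that m by auto
  qed
  \<comment> \<open>\<open>p\<close> vanishes near \<open>t\<close>, hence so does its derivative
    \<open>k t * c t\<close>, and \<open>nz\<close> excludes \<open>c t = 0\<close>.\<close>
  have k0: "k t = 0" if "t \<in> {a<..<b} - {m}" for t
  proof -
    have "(p has_real_derivative 0) (at t)"
      by (rule has_field_derivative_transform_within_open[of "\<lambda>_. 0" _ _ "{a<..<b} - {m}"])
        (use that p0 in auto)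
    then have "k t * c t = 0"
      using dp DERIV_unique by blast
    then show ?thesis using nz[of t] p0[OF that] by auto
  qed
  \<comment> \<open>Two distinct points of zero curvature already contradict injectivity of
    \<open>k\<close>.\<close>
  have "infinite ({a<..<b} - {m})"
    using \<open>a < b\<close> by simp
  then obtain u v where "u \<in> {a<..<b} - {m}" "v \<in> {a<..<b} - {m}" "u \<noteq> v"
    by (metis finite.emptyI finite_insert ex_in_conv insertCI subsetI finite_subset singletonI)
  then show False
    using k0[of u] k0[of v] inj_onD[OF inj, of u v] by auto
qed

section \<open>Arcs of closed convex curves\<close>

text \<open>Points with equal values have the same residue modulo \<open>L\<close>, so they differ
  by an integer multiple of \<open>L\<close>; in an interval shorter than \<open>L\<close> the
  multiple is zero.\<close>

lemma periodic_inj_on_interval: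
  fixes f :: "real \<Rightarrow> 'a"
  assumes per: "\<And>x. f (x + L) = f x" and "0 < L" and inj: "inj_on f {0..<L}" and "b < a + L"
  shows "inj_on f {a..b}"
proof (rule inj_onI)
  interpret periodic_fun_simple f L by standard (rule per)
  define r where "r x = x - of_int \<lfloor>x / L\<rfloor> * L" for x
  have r: "r x \<in> {0..<L}" for x
    using floor_divide_lower[OF \<open>0 < L\<close>, of x] floor_divide_upper[OF \<open>0 < L\<close>, of x]
    by (auto simp: r_def algebra_simps)
  fix x y assume xy: "x \<in> {a..b}" "y \<in> {a..b}" "f x = f y"
  have "f (r x) = f (r y)"
    using xy by (simp add: r_def minus_of_int)
  then have "r x = r y" using inj r by (auto dest: inj_onD)
  then have e: "x - y = of_int (\<lfloor>x / L\<rfloor> - \<lfloor>y / L\<rfloor>) * L"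
    by (simp add: r_def algebra_simps)
  have "\<bar>x - y\<bar> < L" using xy \<open>b < a + L\<close> by auto
  then have "\<bar>real_of_int (\<lfloor>x / L\<rfloor> - \<lfloor>y / L\<rfloor>)\<bar> < 1"
    using \<open>0 < L\<close> unfolding e by (simp add: abs_mult)
  then have "\<lfloor>x / L\<rfloor> - \<lfloor>y / L\<rfloor> = 0" by linarith
  with e show "x = y" by simp
qed

text \<open>On an arc shorter than a period, distinct parameters give distinct points, and
  parameters of equal level are points on one line normal to \<open>w\<close>.\<close>

lemma levels_at_most_twice_convex_curve:
  assumes "closed_convex_curve \<Gamma>" and "b < a + 2 * pi" and "w \<noteq> 0"
  shows "levels_at_most_twice (\<lambda>t. w \<bullet> \<Gamma> t) {a..b}"
proof -
  obtain K where K: "convex K" "interior K \<noteq> {}" "frontier K = range \<Gamma>"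
    using assms(1) unfolding closed_convex_curve_def by blast
  have inj: "inj_on \<Gamma> {a..b}"
    using assms by (intro periodic_inj_on_interval[of _ "2 * pi"]) (auto simp: closed_convex_curve_def)
  have False if pqr: "p \<in> {a..b}" "q \<in> {a..b}" "r \<in> {a..b}" "p < q" "q < r"
    "w \<bullet> \<Gamma> p = w \<bullet> \<Gamma> q" "w \<bullet> \<Gamma> q = w \<bullet> \<Gamma> r" "w \<bullet> \<Gamma> u < w \<bullet> \<Gamma> q" "w \<bullet> \<Gamma> q < w \<bullet> \<Gamma> v" for p q r u v
  proof -
    have "\<Gamma> p \<noteq> \<Gamma> q" "\<Gamma> q \<noteq> \<Gamma> r" "\<Gamma> p \<noteq> \<Gamma> r"
      using pqr(1-5) inj by (simp_all add: inj_on_eq_iff)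
    then show False
      using line_meets_convex_frontier_twice[OF K(1,2) _ _ _ _ _ _ \<open>w \<noteq> 0\<close> pqr(6) refl
          pqr(7)[symmetric] _ _ pqr(8,9)] K(3) by blast
  qed
  then show ?thesis unfolding levels_at_most_twice_def by blast
qed

lemma smooth_curve_iterated_deriv:
  assumes "smooth_curve f"
  shows "(iterated_vector_derivative n f has_vector_derivative
    iterated_vector_derivative (Suc n) f x) (at x)"
  using assms unfolding smooth_curve_def
  by (simp add: iterated_vector_derivative_def vector_derivative_works[symmetric])

lemma has_real_derivative_inner_right:
  assumes "(f has_vector_derivative f') (at x)"
  shows "((\<lambda>x. w \<bullet> f x) has_real_derivative w \<bullet> f') (at x)"
  using bounded_linear.has_vector_derivative[OF bounded_linear_inner_right assms]
  by (simp add: has_real_derivative_iff_has_vector_derivative)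

text \<open>Differentiating \<open>T x \<bullet> T x = 1\<close> makes \<open>W x\<close> orthogonal
  to \<open>T x\<close>, so it is the curvature times the quarter turn of
  \<open>T x\<close>.\<close>

lemma unit_speed_frenet:
  assumes "smooth_curve \<Gamma>" and unit: "\<And>x. norm (vector_derivative \<Gamma> (at x)) = 1"
  defines "T \<equiv> iterated_vector_derivative 1 \<Gamma>" and "W \<equiv> iterated_vector_derivative 2 \<Gamma>"
  shows "W x $ 1 = - (curvature \<Gamma> x * T x $ 2)" "W x $ 2 = curvature \<Gamma> x * T x $ 1"
    "(T x $ 1)\<^sup>2 + (T x $ 2)\<^sup>2 = 1" "continuous_on S (curvature \<Gamma>)"
proof -
  have T: "norm (T x) = 1" for x
    using unit by (simp add: T_def iterated_vector_derivative_def)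
  have TT: "T x \<bullet> T x = 1" for x
    using T by (simp add: norm_eq_1)
  then show "(T x $ 1)\<^sup>2 + (T x $ 2)\<^sup>2 = 1"
    by (simp add: inner_vec_def sum_2 power2_eq_square)
  have dT: "(T has_vector_derivative W x) (at x)" for x
    using smooth_curve_iterated_deriv[OF assms(1), of 1 x] by (simp add: T_def W_def numeral_2_eq_2)
  have dW: "(W has_vector_derivative iterated_vector_derivative 3 \<Gamma> x) (at x)" for x
    using smooth_curve_iterated_deriv[OF assms(1), of 2 x] by (simp add: W_def numeral_3_eq_3 numeral_2_eq_2)
  have k: "curvature \<Gamma> x = T x $ 1 * W x $ 2 - T x $ 2 * W x $ 1" for x
    using T by (simp add: curvature_def Let_def T_def W_def)
  have "((\<lambda>x. T x \<bullet> T x) has_vector_derivative T x \<bullet> W x + W x \<bullet> T x) (at x)"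
    by (rule bounded_bilinear.has_vector_derivative[OF bounded_bilinear_inner dT dT])
  then have "T x \<bullet> W x + W x \<bullet> T x = 0"
    unfolding TT using vector_derivative_unique_at has_vector_derivative_const by blast
  then have "T x $ 1 * W x $ 1 + T x $ 2 * W x $ 2 = 0"
    by (simp add: inner_commute inner_vec_def sum_2)
  moreover note k[of x]
  moreover have "T x $ 1 * T x $ 1 + T x $ 2 * T x $ 2 = 1"
    using TT[of x] by (simp add: inner_vec_def sum_2)
  \<comment> \<open>Orthogonality and the curvature formula are two linear equations for the
    components of \<open>W x\<close>; their determinant is the squared speed, 1.\<close>
  ultimately show "W x $ 1 = - (curvature \<Gamma> x * T x $ 2)" "W x $ 2 = curvature \<Gamma> x * T x $ 1"
    by algebra+
  have "continuous_on S T" "continuous_on S W"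
    using dT dW by (meson has_vector_derivative_continuous continuous_at_imp_continuous_on)+
  then show "continuous_on S (curvature \<Gamma>)"
    unfolding k[abs_def] by (intro continuous_intros)
qed

section \<open>The chord of an arc without a vertex\<close>

theorem theorem3:
  fixes \<Gamma> :: "real \<Rightarrow> real^2" and \<rho> :: real
  assumes "bicycle_curve \<Gamma> \<rho>"
  shows "\<forall>a. \<exists>x\<in>{a..a + 2 * pi * \<rho>}. vertex_at \<Gamma> x"
proof (intro allI, rule ccontr)
  fix a
  define s where "s = 2 * pi * \<rho>"
  define b where "b = a + s"
  assume "\<not> (\<exists>x\<in>{a..a + 2 * pi * \<rho>}. vertex_at \<Gamma> x)"
  then have no_vertex: "\<not> vertex_at \<Gamma> x" if "x \<in> {a<..<b}" for x
    using that by (auto simp: b_def s_def)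
  obtain l where cc: "closed_convex_curve \<Gamma>" and \<rho>: "0 < \<rho>" "\<rho> < 1"
    and l: "\<And>x. dist (\<Gamma> (x + s)) (\<Gamma> x) = l"
    using assms unfolding bicycle_curve_def s_def by blast
  have ab: "a < b" "b < a + 2 * pi" using \<rho> by (simp_all add: b_def s_def)
  have sm: "smooth_curve \<Gamma>" and unit: "\<And>x. norm (vector_derivative \<Gamma> (at x)) = 1"
    using cc by (auto simp: closed_convex_curve_def)
  define T where "T = iterated_vector_derivative 1 \<Gamma>"
  define W where "W = iterated_vector_derivative 2 \<Gamma>"
  define k where "k = curvature \<Gamma>"
  note fr = unit_speed_frenet[OF sm unit, folded T_def W_def k_def]
  have dG: "(\<Gamma> has_vector_derivative T x) (at x)" for x
    using smooth_curve_iterated_deriv[OF sm, of 0 x] by (simp add: T_def iterated_vector_derivative_def)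
  have dT: "(T has_vector_derivative W x) (at x)" for x
    using smooth_curve_iterated_deriv[OF sm, of 1 x] by (simp add: T_def W_def numeral_2_eq_2)
  define D where "D = \<Gamma> b - \<Gamma> a"
  \<comment> \<open>The quarter turn of the chord, so that \<open>w \<bullet> \<Gamma> t\<close> is,
    up to a constant, the height over the chord times the chord length.\<close>
  define w :: "real^2" where "w = vector [- D $ 2, D $ 1]"
  have "inj_on \<Gamma> {a..b}"
    using cc ab by (intro periodic_inj_on_interval[of _ "2 * pi"]) (auto simp: closed_convex_curve_def)
  then have "D \<noteq> 0" using ab by (auto simp: D_def inj_on_eq_iff)
  then have "w \<noteq> 0" by (auto simp: w_def vec_eq_iff forall_2)
  have bicycle: "D \<bullet> T a = D \<bullet> T b"
  proof -
    \<comment> \<open>The moving chord, with \<open>E a = D\<close>; its squared length is constant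
      and is differentiated at \<open>a\<close>.\<close>
    define E where "E x = \<Gamma> (x + s) - \<Gamma> x" for x
    have dE: "(E has_vector_derivative T (x + s) - T x) (at x)" for x
    proof -
      have "((\<lambda>x. x + s) has_vector_derivative 1) (at x)"
        by (auto intro!: derivative_eq_intros)
      then have "((\<Gamma> \<circ> (\<lambda>x. x + s)) has_vector_derivative 1 *\<^sub>R T (x + s)) (at x)"
        by (rule vector_diff_chain_at) (rule dG)
      from has_vector_derivative_diff[OF this dG] show ?thesis
        by (simp add: E_def[abs_def] o_def)
    qed
    have "((\<lambda>x. E x \<bullet> E x) has_vector_derivative
      E a \<bullet> (T (a + s) - T a) + (T (a + s) - T a) \<bullet> E a) (at a)"
      by (rule bounded_bilinear.has_vector_derivative[OF bounded_bilinear_inner dE dE])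
    moreover have "E x \<bullet> E x = l\<^sup>2" for x
      using l[of x] by (simp add: E_def dist_norm power2_norm_eq_inner[symmetric])
    ultimately have "E a \<bullet> (T (a + s) - T a) + (T (a + s) - T a) \<bullet> E a = 0"
      by (simp only:) (rule vector_derivative_unique_at[OF _ has_vector_derivative_const])
    then show ?thesis
      by (simp add: E_def D_def b_def inner_commute inner_diff_right inner_diff_left)
  qed
  have "inj_on k {a..b}"
    unfolding k_def
    by (rule inj_on_if_no_local_extremum[OF unit_speed_frenet(4)[OF sm unit]])
      (use no_vertex in \<open>auto simp: vertex_at_def\<close>)
  \<comment> \<open>\<open>W t\<close> is \<open>k t\<close> times the quarter turn of
    \<open>T t\<close>. Moved across the inner product, the quarter turn sends \<open>D\<close> to
    \<open>- w\<close> here and \<open>w\<close> to \<open>D\<close> in the next claim.\<close>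
  moreover have "((\<lambda>t. D \<bullet> T t) has_real_derivative - (k t * (w \<bullet> T t))) (at t)" for t
    using has_real_derivative_inner_right[OF dT, of D t] fr(1,2)[of t]
    by (simp add: w_def inner_vec_def sum_2 algebra_simps)
  moreover have "((\<lambda>t. w \<bullet> T t) has_real_derivative k t * (D \<bullet> T t)) (at t)" for t
    using has_real_derivative_inner_right[OF dT, of w t] fr(1,2)[of t]
    by (simp add: w_def inner_vec_def sum_2 algebra_simps)
  moreover have "w \<bullet> T t \<noteq> 0 \<or> D \<bullet> T t \<noteq> 0" for t
  proof -
    \<comment> \<open>\<open>D\<close> and \<open>w\<close> are orthogonal and equally long, so this
      is Pythagoras for the tangent.\<close>
    have "(w \<bullet> T t)\<^sup>2 + (D \<bullet> T t)\<^sup>2 = (D \<bullet> D) * ((T t $ 1)\<^sup>2 + (T t $ 2)\<^sup>2)"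
      by (simp add: w_def inner_vec_def sum_2 power2_eq_square algebra_simps)
    then show ?thesis using fr(3)[of t] \<open>D \<noteq> 0\<close> by auto
  qed
  moreover have "w \<bullet> \<Gamma> a = w \<bullet> \<Gamma> b"
    by (simp add: w_def D_def inner_vec_def sum_2 algebra_simps)
  ultimately have "D \<bullet> T a \<noteq> D \<bullet> T b"
    using monotone_curvature_unequal_angles[OF ab(1) has_real_derivative_inner_right[OF dG]
        _ _ _ levels_at_most_twice_convex_curve[OF cc ab(2) \<open>w \<noteq> 0\<close>] fr(4)]
    by blast
  with bicycle show False by blast
qed

end
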